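(* Let $n\geq2$, let $B_1,\ldots,B_n$ be arbitrary finite sets, and let $\mathcal{X}=B_1\times\cdots\times B_n$. Let $\mathcal{S}$ be a multiset of subsets of $[n]$ and let $\alpha\colon\mathcal{S}\to\mathbb{R}_+$ be a fractional cover, writing $\alpha_S=\alpha(S)$. Then the following two statements both hold, and they are equivalent: (i) for every set $A\subseteq\mathcal{X}$, \[|A|\leq\prod_{S\in\mathcal{S}}\big|A_S\mid A_{S_*}\big|^{\alpha_S};\] (ii) for every random variable $X=(X_1,\ldots,X_n)$ taking values in $\mathcal{X}$ such that $\mathbf{H}(X)$ is finite, \[\mathbf{H}(X)\leq\sum_{S\in\mathcal{S}}\alpha_S\,\mathbf{H}(X_S\mid X_{S_*}).\]
   Context: $\mathbf{H}$ denotes Shannon entropy and $\mathbf{H}(\cdot\mid\cdot)$ conditional Shannon entropy (with $\mathbf{H}(X_S\mid X_\varnothing)=\mathbf{H}(X_S)$). For $A\subseteq\mathcal{X}$ and $S\subseteq[n]$, $A_S$ is the projection $\pi_S(A)$ of $A$ onto the coordinates indexed by $S$; for a random variable $X=(X_1,\ldots,X_n)$, $X_S=(X_i:i\in S)$. A function $\alpha\colon\mathcal{S}\to\mathbb{R}_+$ is a fractional cover if $\sum_{S\in\mathcal{S}:\, i\in S}\alpha(S)\geq1$ for each $i\in[n]$. For a set $S\subseteq[n]$ with minimal element $a\geq1$, $S_*=[a-1]=\{1,\ldots,a-1\}$ (empty if $a=1$). For $A\subseteq\mathcal{X}$, $S\subseteq[n]$ and $y\in A_S$, $A\mid A_S=y$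 denotes the set of elements of $A$ whose coordinates indexed by $S$ equal $y$, and the average conditioned size is $|A\mid A_S|=\prod_{y\in A_S}|A\mid A_S=y|^{p(y)}$, where $p(y)$ is the probability that $\pi_S(x)=y$ for $x$ chosen uniformly at random from $A$. For $S,T\subseteq[n]$, $A_T\mid A_S$ means $A_T\mid A_{S\cap T}$, with average size $|A_T\mid A_S|=\prod_{y}|A_T\mid A_S=y|^{p(y)}$ defined analogously; by convention, when the conditioning set of coordinates is empty, $|A_T\mid A_\varnothing|=|A_T|$. *)

theory Defs
  imports "HOL-Probability.Probability"
begin

text \<open>
  The space \<open>B\<^sub>1 \<times> \<dots> \<times> B\<^sub>n\<close> is \<open>\<Pi>\<^sub>E i\<in>{1..n}. B i\<close>; the projection onto the coordinates in
  \<open>S\<close> is \<open>\<lambda>x. restrict x S\<close>, whose values lie in \<open>\<Pi>\<^sub>E i\<in>S. B i\<close> if \<open>S \<subseteq> {1..n}\<close>.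
\<close>

definition proj :: "nat set \<Rightarrow> (nat \<Rightarrow> 'b) set \<Rightarrow> (nat \<Rightarrow> 'b) set" where
  "proj S A = (\<lambda>x. restrict x S) ` A"

definition fibre :: "(nat \<Rightarrow> 'b) set \<Rightarrow> nat set \<Rightarrow> (nat \<Rightarrow> 'b) \<Rightarrow> (nat \<Rightarrow> 'b) set" where
  "fibre A S y = {x \<in> A. restrict x S = y}"

text \<open>
  \<open>avg_cond_size A T S\<close> is \<open>|A\<^sub>T | A\<^sub>S|\<close>: the geometric mean, over uniformly random \<open>x \<in> A\<close>, of the
  number of \<open>T\<close>-projections of those elements of \<open>A\<close> that agree with \<open>x\<close> on \<open>S\<close>.
  For \<open>S \<subseteq> T\<close> the \<open>T\<close>-projections of \<open>fibre A S y\<close> are exactly the elements of \<open>A\<^sub>T\<close> whose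
  \<open>S\<close>-coordinates equal \<open>y\<close>. The notation is needed for \<open>S\<close> disjoint from \<open>T\<close>, where
  conditioning must be done in \<open>A\<close> (or \<open>A\<^bsub>S \<union> T\<^esub>\<close>): conditioning the elements of \<open>A\<^sub>T\<close> alone, that
  is, on the coordinates \<open>S \<inter> T = {}\<close> only, would give just \<open>|A\<^sub>T|\<close>, an upper bound for
  \<open>avg_cond_size A T S\<close> by the lemma \<open>avg_cond_size_le_card\<close> below.
\<close>

definition avg_cond_size :: "(nat \<Rightarrow> 'b) set \<Rightarrow> nat set \<Rightarrow> nat set \<Rightarrow> real" where
  "avg_cond_size A T S =
     (if S = {} then real (card (proj T A))
      else (\<Prod>y\<in>proj S A. real (card (proj T (fibre A S y)))
              powr measure_pmf.prob (pmf_of_set A) {x. restrict x S = y}))"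

lemma avg_cond_size_full:
  assumes "A \<subseteq> (\<Pi>\<^sub>E i\<in>{1..n}. B i)" "S \<noteq> {}"
  shows "avg_cond_size A {1..n} S =
    (\<Prod>y\<in>proj S A. real (card (fibre A S y))
       powr measure_pmf.prob (pmf_of_set A) {x. restrict x S = y})"
proof -
  have "proj {1..n} (fibre A S y) = fibre A S y" for y
  proof -
    have "restrict x {1..n} = x" if "x \<in> fibre A S y" for x
      using that assms(1) by (auto simp: fibre_def intro!: PiE_restrict)
    then show ?thesis by (force simp: proj_def)
  qed
  then show ?thesis using assms(2) by (simp add: avg_cond_size_def)
qed

lemma avg_cond_size_le_card:
  assumes A: "finite A" "A \<noteq> {}"
  shows "avg_cond_size A T S \<le> real (card (proj T A))"
proof (cases "S = {}")
  case False
  let ?p = "\<lambda>y. measure_pmf.prob (pmf_of_set A) {x. restrict x S = y}"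
  let ?c = "real (card (proj T A))"
  have c: "0 < ?c" using A by (simp add: proj_def card_gt_0_iff)
  have fin: "finite (proj S A)" using A by (simp add: proj_def)
  have "(\<Sum>y\<in>proj S A. ?p y) =
      measure_pmf.prob (pmf_of_set A) (\<Union>y\<in>proj S A. {x. restrict x S = y})"
    by (rule measure_pmf.finite_measure_finite_Union[symmetric])
       (use fin in \<open>auto simp: disjoint_family_on_def\<close>)
  also have "\<dots> = 1"
    using A by (subst measure_pmf.prob_eq_1) (auto simp: AE_measure_pmf_iff proj_def)
  finally have sum: "(\<Sum>y\<in>proj S A. ?p y) = 1" .
  have "avg_cond_size A T S \<le> (\<Prod>y\<in>proj S A. ?c powr ?p y)"
    unfolding avg_cond_size_def using False A
    by (auto intro!: prod_mono powr_mono2 card_mono simp: proj_def fibre_def)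
  also have "\<dots> = ?c powr (\<Sum>y\<in>proj S A. ?p y)"
    using c fin by (intro powr_sum[symmetric]) auto
  finally show ?thesis using c sum by simp
qed (simp add: avg_cond_size_def)

text \<open>The empty set, which has no minimal element, contributes a factor 1 (if \<open>A \<noteq> {}\<close>) or a
  summand 0 whatever it is conditioned on.\<close>

definition lower_star :: "nat set \<Rightarrow> nat set" where
  "lower_star S = (if S = {} then {} else {1..<Min S})"

text \<open>
  A function on a multiset assigns a value to each occurrence; \<open>(S, k)\<close> stands for the
  \<open>k\<close>-th copy of \<open>S\<close>, so equal sets may carry different weights.
\<close>

definition occs :: "'c multiset \<Rightarrow> ('c \<times> nat) set" where
  "occs \<S> = {(S, k). k < count \<S> S}"

definition fractional_cover ::
    "nat \<Rightarrow> nat set multiset \<Rightarrow> (nat set \<times> nat \<Rightarrow> real) \<Rightarrow> bool" where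
  "fractional_cover n \<S> \<alpha> \<longleftrightarrow>
     (\<forall>s\<in>occs \<S>. 0 \<le> \<alpha> s) \<and>
     (\<forall>i\<in>{1..n}. 1 \<le> (\<Sum>s\<in>{s \<in> occs \<S>. i \<in> fst s}. \<alpha> s))"

text \<open>
  Shannon entropies to base \<open>b\<close> of random variables with finite range; these are the
  abbreviations \<open>\<H>(X)\<close> and \<open>\<H>(X | Y)\<close> of the locale \<open>information_space\<close>. For constant \<open>Y\<close>, as
  for \<open>Y = X\<^bsub>{}\<^esub>\<close>, the latter is \<open>\<H>(X)\<close>.
\<close>

abbreviation entropy_rv :: "real \<Rightarrow> 'a measure \<Rightarrow> ('a \<Rightarrow> 'c) \<Rightarrow> real" where
  "entropy_rv b M X \<equiv> prob_space.entropy M b (count_space (X ` space M)) X"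

abbreviation cond_entropy_rv ::
    "real \<Rightarrow> 'a measure \<Rightarrow> ('a \<Rightarrow> 'c) \<Rightarrow> ('a \<Rightarrow> 'd) \<Rightarrow> real" where
  "cond_entropy_rv b M X Y \<equiv>
     prob_space.conditional_entropy M b (count_space (X ` space M)) (count_space (Y ` space M)) X Y"

lemma cond_entropy_rv_const:
  assumes "prob_space M" "1 < b" "simple_function M X"
  shows "cond_entropy_rv b M X (\<lambda>_. c) = entropy_rv b M X"
proof -
  interpret information_space M b
    using assms by (simp add: information_space_def information_space_axioms_def)
  have c: "simple_function M (\<lambda>_. c)" by simp
  have "simple_distributed M (\<lambda>_. c) (\<lambda>_. 1)"
    using prob_space by (intro simple_distributedI[OF c]) auto
  from entropy_simple_distributed[OF this] have "\<H>(\<lambda>_. c) = 0"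
    by (auto simp: image_def)
  moreover have "\<H>(\<lambda>x. (c, X x)) = \<H>(\<lambda>_. c) + \<H>(X | \<lambda>_. c)"
    by (rule entropy_chain_rule[OF c assms(3)])
  moreover have "\<H>(snd \<circ> (\<lambda>x. (c, X x))) \<le> \<H>(\<lambda>x. (c, X x))"
    by (intro entropy_data_processing simple_function_Pair c assms(3))
  moreover have "\<H>(X | \<lambda>_. c) \<le> \<H>(X)"
    by (rule conditional_entropy_less_eq_entropy[OF assms(3) c])
  ultimately show ?thesis by (simp add: comp_def)
qed

end

theory Submission
  imports Defs
begin

text \<open>
  By the chain rule, \<open>H(X)\<close> is the sum of the \<open>g i = H(X\<^sub>i | X\<^sub>1, \<dots>, X\<^bsub>i-1\<^esub>)\<close>, and \<open>H(X\<^sub>S | X\<^bsub>S_*\<^esub>)\<close> is a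
  sum over \<open>i \<in> S\<close> of entropies of \<open>X\<^sub>i\<close> given only coordinates below \<open>i\<close>, hence at least the
  sum of the \<open>g i\<close> over \<open>S\<close>. Since \<open>g i \<ge> 0\<close>, weighting by a fractional cover gives (ii). For (i),
  apply (ii) to a uniformly random element of \<open>A\<close>: its entropy is \<open>log |A|\<close>, and the conditional
  entropies are at most the logarithms of the average conditioned sizes. Both this bound and the
  fact that conditioning on more reduces entropy are instances of Gibbs' inequality.
\<close>

section \<open>Expectations and conditional entropies of finite-range variables\<close>

lemma (in prob_space) simple_distributed_vimage:
  assumes "simple_function M X"
  shows "simple_distributed M X (\<lambda>x. prob (X -` {x} \<inter> space M))"
  using simple_distributedI[OF assms measure_nonneg refl] .

lemma (in prob_space) expectation_simple_function:
  fixes g :: "'c \<Rightarrow> real"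
  assumes X: "simple_function M X"
  shows "expectation (\<lambda>\<omega>. g (X \<omega>)) = (\<Sum>x\<in>X ` space M. prob (X -` {x} \<inter> space M) * g x)"
proof -
  let ?p = "\<lambda>x. prob (X -` {x} \<inter> space M)"
  have fin: "finite (X ` space M)" using simple_functionD(1)[OF X] .
  have "expectation (\<lambda>\<omega>. g (X \<omega>)) = (\<integral>x. ?p x * g x \<partial>count_space (X ` space M))"
    using simple_distributed[OF simple_distributed_vimage[OF X]]
    by (intro distributed_integral[symmetric]) auto
  then show ?thesis by (simp add: lebesgue_integral_count_space_finite[OF fin])
qed

lemma (in prob_space) sum_prob_vimage:
  assumes X: "simple_function M X" and Y: "simple_function M Y"
  shows "(\<Sum>x\<in>X ` space M. prob ((\<lambda>\<omega>. (X \<omega>, Y \<omega>)) -` {(x, y)} \<inter> space M)) =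
    prob (Y -` {y} \<inter> space M)"
proof -
  note XY = simple_function_Pair[OF X Y]
  have "(\<Sum>x\<in>X ` space M. prob ((\<lambda>\<omega>. (X \<omega>, Y \<omega>)) -` {(x, y)} \<inter> space M)) =
      prob (\<Union>x\<in>X ` space M. (\<lambda>\<omega>. (X \<omega>, Y \<omega>)) -` {(x, y)} \<inter> space M)"
    using simple_functionD[OF X] simple_functionD[OF XY]
    by (intro finite_measure_finite_Union[symmetric]) (auto simp: disjoint_family_on_def)
  also have "(\<Union>x\<in>X ` space M. (\<lambda>\<omega>. (X \<omega>, Y \<omega>)) -` {(x, y)} \<inter> space M) = Y -` {y} \<inter> space M"
    by auto
  finally show ?thesis .
qed

text \<open>As expectations over the sample space, entropies of \<open>X\<close> given different
  variables can be compared although their sums run over different index sets.\<close>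

lemma (in information_space) conditional_entropy_eq_expectation:
  assumes X: "simple_function M X" and Y: "simple_function M Y"
  shows "\<H>(X | Y) = expectation (\<lambda>\<omega>.
    - log b (prob ((\<lambda>\<omega>. (X \<omega>, Y \<omega>)) -` {(X \<omega>, Y \<omega>)} \<inter> space M) / prob (Y -` {Y \<omega>} \<inter> space M)))"
  using expectation_simple_function[OF simple_function_Pair[OF X Y], of "\<lambda>(x, y).
      - log b (prob ((\<lambda>\<omega>. (X \<omega>, Y \<omega>)) -` {(x, y)} \<inter> space M) / prob (Y -` {y} \<inter> space M))"]
    conditional_entropy_eq[OF simple_distributed_vimage[OF Y]
      simple_distributed_vimage[OF simple_function_Pair[OF X Y]]]
  by (simp add: case_prod_beta' sum_negf)

text \<open>Gibbs' inequality: \<open>q\<close> is a candidate for the conditional law of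
  \<open>X\<close> given \<open>Y\<close>, possibly of total mass below 1. With \<open>p\<close> the
  joint law and \<open>r\<close> the law of \<open>Y\<close>, apply ln t \<le> t - 1 to t = r q / p
  and sum with weights \<open>p\<close>; the bound vanishes because r q has total mass at most
  1.\<close>

lemma (in information_space) conditional_entropy_le_cross_entropy:
  assumes X: "simple_function M X" and Y: "simple_function M Y"
    and nonneg: "\<And>x y. 0 \<le> q x y"
    and pos: "\<And>x y. 0 < prob ((\<lambda>\<omega>. (X \<omega>, Y \<omega>)) -` {(x, y)} \<inter> space M) \<Longrightarrow> 0 < q x y"
    and sum: "\<And>y. y \<in> Y ` space M \<Longrightarrow> (\<Sum>x | (x, y) \<in> (\<lambda>\<omega>. (X \<omega>, Y \<omega>)) ` space M. q x y) \<le> 1"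
  shows "\<H>(X | Y) \<le> expectation (\<lambda>\<omega>. - log b (q (X \<omega>) (Y \<omega>)))"
proof -
  define p where "p x y = prob ((\<lambda>\<omega>. (X \<omega>, Y \<omega>)) -` {(x, y)} \<inter> space M)" for x y
  define r where "r y = prob (Y -` {y} \<inter> space M)" for y
  let ?I = "(\<lambda>\<omega>. (X \<omega>, Y \<omega>)) ` space M"
  note XY = simple_function_Pair[OF X Y]
  have fin: "finite ?I" "finite (X ` space M)" "finite (Y ` space M)"
    using simple_functionD(1) X Y XY by blast+
  have r1: "(\<Sum>y\<in>Y ` space M. r y) = 1"
    using expectation_simple_function[OF Y, of "\<lambda>_. 1"] prob_space by (simp add: r_def)
  have p1: "(\<Sum>(x, y)\<in>?I. p x y) = 1"
    using expectation_simple_function[OF XY, of "\<lambda>_. 1"] prob_space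
    by (simp add: p_def case_prod_beta')
  \<comment> \<open>Grouping the joint range by \<open>y\<close> exposes the inner sums that the
    assumption \<open>sum\<close> bounds by 1.\<close>
  have swap: "(\<Sum>(x, y)\<in>?I. r y * q x y) = (\<Sum>y\<in>Y ` space M. r y * (\<Sum>x | (x, y) \<in> ?I. q x y))"
  proof -
    have "(\<Sum>y\<in>Y ` space M. r y * (\<Sum>x | (x, y) \<in> ?I. q x y)) =
        (\<Sum>(y, x)\<in>(SIGMA y:Y ` space M. {x. (x, y) \<in> ?I}). r y * q x y)"
      using fin by (subst sum.Sigma[symmetric])
        (auto simp: sum_distrib_left intro: finite_subset[of _ "X ` space M"])
    also have "\<dots> = (\<Sum>(x, y)\<in>?I. r y * q x y)"
      by (rule sum.reindex_bij_witness[of _ prod.swap prod.swap]) auto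
    finally show ?thesis by simp
  qed
  have ln_b: "0 < ln b" using b_gt_1 by simp
  have "\<H>(X | Y) - expectation (\<lambda>\<omega>. - log b (q (X \<omega>) (Y \<omega>))) =
      (\<Sum>(x, y)\<in>?I. p x y * - log b (p x y / r y)) - (\<Sum>(x, y)\<in>?I. p x y * - log b (q x y))"
    using expectation_simple_function[OF XY, of "\<lambda>(x, y). - log b (q x y)"]
      expectation_simple_function[OF XY, of "\<lambda>(x, y). - log b (p x y / r y)"]
      conditional_entropy_eq_expectation[OF X Y]
    by (simp add: p_def r_def case_prod_beta')
  also have "\<dots> = (\<Sum>(x, y)\<in>?I. p x y * log b (q x y) - p x y * log b (p x y / r y))"
    by (simp add: sum_subtractf case_prod_beta' sum_negf)
  also have "\<dots> \<le> (\<Sum>(x, y)\<in>?I. (r y * q x y - p x y) / ln b)"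
  proof (rule sum_mono, clarify)
    fix \<omega> assume "\<omega> \<in> space M"
    define x y where "x = X \<omega>" and "y = Y \<omega>"
    show "p (X \<omega>) (Y \<omega>) * log b (q (X \<omega>) (Y \<omega>)) - p (X \<omega>) (Y \<omega>) * log b (p (X \<omega>) (Y \<omega>) / r (Y \<omega>))
        \<le> (r (Y \<omega>) * q (X \<omega>) (Y \<omega>) - p (X \<omega>) (Y \<omega>)) / ln b"
      unfolding x_def[symmetric] y_def[symmetric]
    proof (cases "p x y = 0")
      \<comment> \<open>Here the left side is 0 whatever value the logarithms take, and the right
        side is nonnegative.\<close>
      case True
      then show "p x y * log b (q x y) - p x y * log b (p x y / r y) \<le> (r y * q x y - p x y) / ln b"
        using nonneg ln_b by (simp add: r_def)
    next
      case False
      then have p0: "0 < p x y" by (simp add: p_def zero_less_measure_iff)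
      have q0: "0 < q x y" using pos p0 by (simp add: p_def)
      have "p x y \<le> r y" unfolding p_def r_def
        using simple_functionD(2)[OF Y] by (intro finite_measure_mono) auto
      then have r0: "0 < r y" using p0 by simp
      \<comment> \<open>All three quantities are positive, so the two logarithms merge into that of
        t = r q / p.\<close>
      have "p x y * log b (q x y) - p x y * log b (p x y / r y) = p x y * ln (r y * q x y / p x y) / ln b"
        using p0 q0 r0 ln_b by (simp add: log_def ln_mult ln_div field_simps)
      also have "\<dots> \<le> p x y * (r y * q x y / p x y - 1) / ln b"
        using p0 q0 r0 ln_b by (intro divide_right_mono mult_left_mono ln_le_minus_one) auto
      also have "\<dots> = (r y * q x y - p x y) / ln b"
        using p0 by (simp add: right_diff_distrib)
      finally show "p x y * log b (q x y) - p x y * log b (p x y / r y) \<le> (r y * q x y - p x y) / ln b" .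
    qed
  qed
  also have "\<dots> = ((\<Sum>y\<in>Y ` space M. r y * (\<Sum>x | (x, y) \<in> ?I. q x y)) - 1) / ln b"
    unfolding swap[symmetric] p1[symmetric]
    by (simp add: case_prod_beta' sum_subtractf sum_divide_distrib diff_divide_distrib)
  also have "\<dots> \<le> ((\<Sum>y\<in>Y ` space M. r y * 1) - 1) / ln b"
    using ln_b sum by (intro divide_right_mono diff_right_mono sum_mono mult_left_mono) (auto simp: r_def)
  finally show ?thesis using r1 by simp
qed

text \<open>Gibbs' inequality with \<open>q\<close> the conditional law of \<open>X\<close> given
  \<open>f \<circ> Y\<close>, read off at \<open>f y\<close>: its cross entropy is exactly the
  right-hand side.\<close>

lemma (in information_space) conditional_entropy_le_comp:
  assumes X: "simple_function M X" and Y: "simple_function M Y"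
  shows "\<H>(X | Y) \<le> \<H>(X | f \<circ> Y)"
proof -
  note fY = simple_function_compose[OF Y, of f]
  note XfY = simple_function_Pair[OF X fY]
  let ?p = "\<lambda>x z. prob ((\<lambda>\<omega>. (X \<omega>, (f \<circ> Y) \<omega>)) -` {(x, z)} \<inter> space M)"
  let ?r = "\<lambda>z. prob ((f \<circ> Y) -` {z} \<inter> space M)"
  let ?q = "\<lambda>x y. ?p x (f y) / ?r (f y)"
  have "\<H>(X | Y) \<le> expectation (\<lambda>\<omega>. - log b (?q (X \<omega>) (Y \<omega>)))"
  proof (rule conditional_entropy_le_cross_entropy[OF X Y])
    fix x y assume *: "0 < prob ((\<lambda>\<omega>. (X \<omega>, Y \<omega>)) -` {(x, y)} \<inter> space M)"
    also have "\<dots> \<le> ?p x (f y)"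
      using simple_functionD(2)[OF XfY] by (intro finite_measure_mono) auto
    also have "\<dots> \<le> ?r (f y)"
      using simple_functionD(2)[OF fY] by (intro finite_measure_mono) auto
    finally have "0 < ?r (f y)" .
    moreover have "0 < ?p x (f y)"
      using * \<open>_ \<le> ?p x (f y)\<close> by linarith
    ultimately show "0 < ?q x y" by simp
  next
    fix y
    have "(\<Sum>x | (x, y) \<in> (\<lambda>\<omega>. (X \<omega>, Y \<omega>)) ` space M. ?q x y) \<le> (\<Sum>x\<in>X ` space M. ?q x y)"
      using simple_functionD(1)[OF X] by (intro sum_mono2) auto
    also have "\<dots> = ?r (f y) / ?r (f y)"
      unfolding sum_divide_distrib[symmetric] sum_prob_vimage[OF X fY] ..
    \<comment> \<open>The quotient is 1, or 0 by the convention for division by zero if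
      \<open>f y\<close> has probability 0.\<close>
    also have "\<dots> \<le> 1" by simp
    finally show "(\<Sum>x | (x, y) \<in> (\<lambda>\<omega>. (X \<omega>, Y \<omega>)) ` space M. ?q x y) \<le> 1" .
  qed simp
  also have "\<dots> = \<H>(X | f \<circ> Y)"
    unfolding conditional_entropy_eq_expectation[OF X fY] by simp
  finally show ?thesis .
qed

section \<open>Chain rule for coordinate projections\<close>

definition coords :: "('a \<Rightarrow> nat \<Rightarrow> 'b) \<Rightarrow> nat set \<Rightarrow> 'a \<Rightarrow> nat \<Rightarrow> 'b" where
  "coords X S = (\<lambda>\<omega>. restrict (X \<omega>) S)"

context information_space
begin

context
  fixes X :: "'a \<Rightarrow> nat \<Rightarrow> 'c"
  assumes X: "simple_function M X"
begin

lemma simple_function_coords: "simple_function M (coords X S)"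
  using simple_function_compose[OF X, of "\<lambda>x. restrict x S"] by (simp add: comp_def coords_def)

text \<open>The projection to \<open>T \<union> S\<close> and the pair of projections to
  \<open>T\<close> and \<open>S\<close> determine each other, so they have equal entropy and the
  chain rule for pairs applies.\<close>

lemma entropy_coords_Un: "\<H>(coords X (T \<union> S)) = \<H>(coords X T) + \<H>(coords X S | coords X T)"
proof -
  let ?f = "\<lambda>w. (restrict w T, restrict w S)"
  have "inj_on ?f (coords X (T \<union> S) ` space M)"
  proof (rule inj_onI)
    fix u v assume "u \<in> coords X (T \<union> S) ` space M" "v \<in> coords X (T \<union> S) ` space M" "?f u = ?f v"
    then show "u = v"
      by (auto simp: fun_eq_iff restrict_def coords_def split: if_splits)
  qed
  from entropy_of_inj[OF simple_function_coords this]
  have "\<H>(coords X (T \<union> S)) = \<H>(?f \<circ> coords X (T \<union> S))" by simp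
  also have "?f \<circ> coords X (T \<union> S) = (\<lambda>\<omega>. (coords X T \<omega>, coords X S \<omega>))"
    by (auto simp: fun_eq_iff coords_def)
  also note entropy_chain_rule[OF simple_function_coords simple_function_coords]
  finally show ?thesis .
qed

lemma conditional_entropy_coords_mono:
  assumes "T \<subseteq> U"
  shows "\<H>(coords X S | coords X U) \<le> \<H>(coords X S | coords X T)"
proof -
  have "(\<lambda>x. restrict x T) \<circ> coords X U = coords X T"
    using assms by (auto simp: fun_eq_iff Int_absorb1 coords_def)
  then show ?thesis
    using conditional_entropy_le_comp[OF simple_function_coords simple_function_coords,
        of S U "\<lambda>x. restrict x T"] by simp
qed

lemma entropy_coords_le_sum:
  "\<H>(coords X {1..n}) \<le> (\<Sum>i\<in>{1..n}. \<H>(coords X {i} | coords X {1..<i}))"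
proof (induction n)
  case 0
  \<comment> \<open>The chain rule makes the conditional entropy of the empty projection given
    itself 0. Conditioning on a constant changes nothing, so the plain entropy is 0 too.\<close>
  have "\<H>(coords X {}) = \<H>(coords X {}) + \<H>(coords X {} | coords X {})"
    using entropy_coords_Un[of "{}" "{}"] by simp
  moreover have "\<H>(coords X {}) = \<H>(coords X {} | coords X {})"
    using cond_entropy_rv_const[OF prob_space_axioms b_gt_1 simple_function_coords[of "{}"],
        of "(\<lambda>_. undefined) :: nat \<Rightarrow> 'c"] by (simp add: restrict_def coords_def)
  ultimately have "\<H>(coords X {}) = 0" by linarith
  moreover have "{1..0} = ({} :: nat set)" by simp
  ultimately show ?case by (simp only: sum.empty order_refl)
next
  case (Suc n)
  have "\<H>(coords X {1..Suc n}) = \<H>(coords X {1..n}) + \<H>(coords X {Suc n} | coords X {1..<Suc n})"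
    using entropy_coords_Un[of "{1..n}" "{Suc n}"]
    by (simp add: atLeastAtMostSuc_conv atLeastLessThanSuc_atLeastAtMost)
  then show ?case using Suc by simp
qed

text \<open>Build \<open>S\<close> up by adding a new largest element \<open>m\<close>: the chain
  rule adds the entropy of coordinate \<open>m\<close> given \<open>T \<union> S\<close>, and this
  set lies in \<open>{1..<m}\<close>, so conditioning on all of \<open>{1..<m}\<close> gives at most
  that. Any \<open>T\<close> below \<open>S\<close> is allowed, since this condition passes to
  subsets of \<open>S\<close> while \<open>T\<close> stays fixed.\<close>

lemma sum_le_conditional_entropy_coords:
  assumes "finite S" "S \<subseteq> {1..}" "\<And>i. i \<in> S \<Longrightarrow> T \<subseteq> {1..<i}"
  shows "(\<Sum>i\<in>S. \<H>(coords X {i} | coords X {1..<i})) \<le> \<H>(coords X S | coords X T)"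
  using assms
proof (induction S rule: finite_linorder_max_induct)
  case empty
  show ?case
    unfolding sum.empty by (intro conditional_entropy_nonneg simple_function_coords)
next
  case (insert m S)
  have "\<H>(coords X {m} | coords X {1..<m}) \<le> \<H>(coords X {m} | coords X (T \<union> S))"
    using insert by (intro conditional_entropy_coords_mono) auto
  \<comment> \<open>Expand the entropy on \<open>T \<union> insert m S\<close> in two ways,
    splitting after \<open>T\<close> and after \<open>T \<union> S\<close>, and cancel the entropy
    on \<open>T\<close>.\<close>
  moreover have "\<H>(coords X (insert m S) | coords X T) = \<H>(coords X S | coords X T) + \<H>(coords X {m} | coords X (T \<union> S))"
    using entropy_coords_Un[of T "insert m S"] entropy_coords_Un[of T S] entropy_coords_Un[of "T \<union> S" "{m}"]
    by simp
  moreover have "m \<notin> S" using insert.hyps by auto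
  ultimately show ?case using insert by simp
qed

end

end

section \<open>Weighting by a fractional cover\<close>

lemma occs_subset:
  assumes "s \<in> occs \<S>" "\<And>S. S \<in># \<S> \<Longrightarrow> S \<subseteq> N"
  shows "fst s \<subseteq> N"
proof -
  have "fst s \<in># \<S>"
    using assms(1) by (auto simp: occs_def simp flip: count_greater_zero_iff)
  then show ?thesis by (rule assms(2))
qed

lemma finite_occs: "finite (occs \<S>)"
proof (rule finite_subset)
  show "occs \<S> \<subseteq> set_mset \<S> \<times> {..<size \<S>}"
    using count_le_size[of \<S>]
    by (auto simp: occs_def intro: order.strict_trans2 simp flip: count_greater_zero_iff)
qed auto

text \<open>Double counting of incidences between indices and occurrences: on the right each
  \<open>g i\<close> appears with total weight at least 1, and \<open>g i\<close> is
  nonnegative.\<close>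

lemma fractional_cover_sum_le:
  fixes g :: "nat \<Rightarrow> real"
  assumes cover: "fractional_cover n \<S> \<alpha>"
    and sub: "\<And>S. S \<in># \<S> \<Longrightarrow> S \<subseteq> {1..n}"
    and g: "\<And>i. i \<in> {1..n} \<Longrightarrow> 0 \<le> g i"
  shows "(\<Sum>i\<in>{1..n}. g i) \<le> (\<Sum>s\<in>occs \<S>. \<alpha> s * (\<Sum>i\<in>fst s. g i))"
proof -
  have "(\<Sum>i\<in>{1..n}. g i * 1) \<le> (\<Sum>i\<in>{1..n}. g i * (\<Sum>s\<in>{s \<in> occs \<S>. i \<in> fst s}. \<alpha> s))"
    using cover g unfolding fractional_cover_def by (intro sum_mono mult_left_mono) auto
  also have "\<dots> = (\<Sum>i\<in>{1..n}. \<Sum>s\<in>{s \<in> occs \<S>. i \<in> fst s}. \<alpha> s * g i)"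
    by (simp add: sum_distrib_left mult.commute)
  also have "\<dots> = (\<Sum>s\<in>occs \<S>. \<Sum>i\<in>{i \<in> {1..n}. i \<in> fst s}. \<alpha> s * g i)"
    by (rule sum.swap_restrict) (auto simp: finite_occs)
  also have "\<dots> = (\<Sum>s\<in>occs \<S>. \<alpha> s * (\<Sum>i\<in>fst s. g i))"
  proof (rule sum.cong[OF refl])
    fix s assume "s \<in> occs \<S>"
    from this sub have "fst s \<subseteq> {1..n}" by (rule occs_subset)
    then have "{i \<in> {1..n}. i \<in> fst s} = fst s" by blast
    then show "(\<Sum>i\<in>{i \<in> {1..n}. i \<in> fst s}. \<alpha> s * g i) = \<alpha> s * (\<Sum>i\<in>fst s. g i)"
      by (simp only: sum_distrib_left)
  qed
  finally show ?thesis by simp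
qed

theorem (in information_space) entropy_fractional_cover:
  assumes X: "simple_function M X" and range: "X ` space M \<subseteq> extensional {1..n}"
    and cover: "fractional_cover n \<S> \<alpha>"
    and sub: "\<And>S. S \<in># \<S> \<Longrightarrow> S \<subseteq> {1..n}"
  shows "\<H>(X) \<le> (\<Sum>(S, k)\<in>occs \<S>. \<alpha> (S, k) *
    \<H>((\<lambda>\<omega>. restrict (X \<omega>) S) | (\<lambda>\<omega>. restrict (X \<omega>) (lower_star S))))"
proof -
  let ?X = "coords X"
  let ?g = "\<lambda>i. \<H>(?X {i} | ?X {1..<i})"
  \<comment> \<open>Extensional functions are fixed by restriction to \<open>{1..n}\<close>, so
    \<open>X\<close> has the same entropy as its full projection.\<close>
  have "inj_on (\<lambda>x. restrict x {1..n}) (X ` space M)"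
    using range by (intro inj_on_inverseI[of _ id]) (auto intro: extensional_restrict)
  from entropy_of_inj[OF X this] have "\<H>(X) = \<H>(?X {1..n})"
    by (simp add: comp_def coords_def)
  also have "\<dots> \<le> (\<Sum>i\<in>{1..n}. ?g i)"
    by (rule entropy_coords_le_sum[OF X])
  also have "\<dots> \<le> (\<Sum>s\<in>occs \<S>. \<alpha> s * (\<Sum>i\<in>fst s. ?g i))"
    by (intro fractional_cover_sum_le[OF cover sub] conditional_entropy_nonneg
        simple_function_coords X)
  also have "\<dots> \<le> (\<Sum>s\<in>occs \<S>. \<alpha> s * \<H>(?X (fst s) | ?X (lower_star (fst s))))"
  proof (intro sum_mono mult_left_mono)
    fix s assume s: "s \<in> occs \<S>"
    from this sub have S: "fst s \<subseteq> {1..n}" by (rule occs_subset)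
    then have fin: "finite (fst s)" by (rule finite_subset) simp
    show "0 \<le> \<alpha> s" using s cover by (simp add: fractional_cover_def)
    show "(\<Sum>i\<in>fst s. ?g i) \<le> \<H>(?X (fst s) | ?X (lower_star (fst s)))"
      \<comment> \<open>Every element of a nonempty set is at least its minimum, so
        \<open>lower_star\<close> of the set lies strictly below all of it.\<close>
      using S fin by (intro sum_le_conditional_entropy_coords X)
        (auto simp: lower_star_def intro: order.strict_trans2)
  qed
  finally show ?thesis by (simp add: case_prod_beta' coords_def)
qed

section \<open>Average conditioned sizes and uniform distributions\<close>

lemma avg_cond_size_pos:
  assumes A: "finite A" "A \<noteq> {}"
  shows "0 < avg_cond_size A T S"
  using A by (auto simp: avg_cond_size_def proj_def fibre_def card_gt_0_iff intro!: prod_pos)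

text \<open>Absorbs the special case \<open>S = {}\<close>: the only projection is then the constant
  function \<open>undefined\<close>, its fibre is \<open>A\<close> and the exponent is 1.\<close>

lemma avg_cond_size_eq_prod:
  assumes A: "finite A" "A \<noteq> {}"
  shows "avg_cond_size A T S = (\<Prod>y\<in>proj S A. real (card (proj T (fibre A S y)))
    powr (real (card (fibre A S y)) / real (card A)))"
proof (cases "S = {}")
  case True
  have "proj {} A = {\<lambda>_. undefined}" "fibre A {} (\<lambda>_. undefined) = A"
    using A by (auto simp: proj_def fibre_def image_iff restrict_def)
  then show ?thesis using A True by (simp add: avg_cond_size_def)
next
  case False
  have "A \<inter> {x. restrict x S = y} = fibre A S y" for y
    by (auto simp: fibre_def)
  then show ?thesis using False A by (simp add: avg_cond_size_def measure_pmf_of_set)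
qed

text \<open>Gibbs' inequality with \<open>q\<close> uniform on the \<open>T\<close>-projection of
  the fibre over \<open>y\<close>. Only an inequality holds in general, as projecting a uniform
  element of a fibre need not give a uniform one.\<close>

lemma uniform_cond_entropy_le_log_avg_cond_size:
  assumes A: "finite A" "A \<noteq> {}" and b: "1 < b"
  shows "cond_entropy_rv b (uniform_count_measure A) (\<lambda>x. restrict x T) (\<lambda>x. restrict x S)
    \<le> log b (avg_cond_size A T S)"
proof -
  let ?M = "uniform_count_measure A"
  interpret prob_space ?M using A by (rule prob_space_uniform_count_measure)
  interpret information_space ?M b by standard (rule b)
  note space_uniform_count_measure [simp]
  have sf: "simple_function ?M (\<lambda>x. restrict x V)" for V
    using A by (auto simp: simple_function_def sets_uniform_count_measure)
  let ?N = "\<lambda>y. real (card (proj T (fibre A S y)))"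
  have N: "0 < ?N y" if "y \<in> proj S A" for y
    using that A by (auto simp: proj_def fibre_def card_gt_0_iff)
  have "cond_entropy_rv b ?M (\<lambda>x. restrict x T) (\<lambda>x. restrict x S) \<le>
      expectation (\<lambda>x. - log b (1 / ?N (restrict x S)))"
  proof (rule conditional_entropy_le_cross_entropy[OF sf sf, where q = "\<lambda>_ y. 1 / ?N y"])
    fix u v :: "nat \<Rightarrow> 'a"
    assume "0 < prob ((\<lambda>x. (restrict x T, restrict x S)) -` {(u, v)} \<inter> space ?M)"
    then have "(\<lambda>x. (restrict x T, restrict x S)) -` {(u, v)} \<inter> space ?M \<noteq> {}"
      by (metis less_irrefl measure_empty)
    \<comment> \<open>Positive probability puts \<open>v\<close> into \<open>proj S A\<close>, where
      fibres are nonempty.\<close>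
    then show "0 < 1 / ?N v" using N[of v] by (auto simp: proj_def)
  next
    fix y assume "y \<in> (\<lambda>x. restrict x S) ` space ?M"
    \<comment> \<open>The values compatible with \<open>y\<close> number exactly
      \<open>?N y\<close>, so their weights \<open>1 / ?N y\<close> add up to at most 1.\<close>
    have "{u. (u, y) \<in> (\<lambda>x. (restrict x T, restrict x S)) ` space ?M} = proj T (fibre A S y)"
      by (auto simp: proj_def fibre_def)
    then show "(\<Sum>u | (u, y) \<in> (\<lambda>x. (restrict x T, restrict x S)) ` space ?M. 1 / ?N y) \<le> 1"
      by simp
  qed simp
  also have "\<dots> = (\<Sum>y\<in>proj S A. real (card (fibre A S y)) / real (card A) * log b (?N y))"
  proof -
    have "prob ((\<lambda>x. restrict x S) -` {y} \<inter> A) = real (card (fibre A S y)) / real (card A)" for y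
      using A by (subst measure_uniform_count_measure)
        (auto simp: fibre_def intro!: arg_cong[of _ _ card])
    moreover have "- log b (1 / t) = log b t" for t
      by (simp add: log_recip)
    ultimately show ?thesis
      using expectation_simple_function[OF sf[of S], of "\<lambda>y. - log b (1 / ?N y)"]
      by (simp add: proj_def)
  qed
  also have "\<dots> = log b (avg_cond_size A T S)"
    unfolding avg_cond_size_eq_prod[OF A] log_def using N
    by (subst ln_prod) (auto simp: sum_divide_distrib A proj_def ln_powr)
  finally show ?thesis .
qed

lemma uniform_entropy_eq_log_card:
  assumes A: "finite A" "A \<noteq> {}" and b: "1 < b"
  shows "entropy_rv b (uniform_count_measure A) (\<lambda>x. x) = log b (real (card A))"
proof -
  let ?M = "uniform_count_measure A"
  interpret prob_space ?M using A by (rule prob_space_uniform_count_measure)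
  interpret information_space ?M b by standard (rule b)
  have sf: "simple_function ?M (\<lambda>x. x)"
    using A by (auto simp: simple_function_def sets_uniform_count_measure space_uniform_count_measure)
  have "simple_distributed ?M (\<lambda>x. x) (\<lambda>x. 1 / real (card A))"
    using A by (intro simple_distributedI[OF sf])
      (auto simp: space_uniform_count_measure measure_uniform_count_measure)
  from entropy_simple_distributed[OF this] show ?thesis
    using A by (simp add: space_uniform_count_measure log_recip)
qed

theorem card_le_prod_avg_cond_size:
  assumes A: "finite A" "A \<subseteq> extensional {1..n}"
    and cover: "fractional_cover n \<S> \<alpha>"
    and sub: "\<And>S. S \<in># \<S> \<Longrightarrow> S \<subseteq> {1..n}"
  shows "real (card A) \<le> (\<Prod>(S, k)\<in>occs \<S>. avg_cond_size A S (lower_star S) powr \<alpha> (S, k))"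
proof (cases "A = {}")
  case True
  \<comment> \<open>There is no uniform distribution on the empty set, but here the left side is
    0.\<close>
  then show ?thesis by (auto intro!: prod_nonneg)
next
  case False
  let ?M = "uniform_count_measure A"
  let ?P = "\<Prod>(S, k)\<in>occs \<S>. avg_cond_size A S (lower_star S) powr \<alpha> (S, k)"
  interpret prob_space ?M using A False by (intro prob_space_uniform_count_measure)
  \<comment> \<open>Base 2 is an arbitrary choice: the logarithms are removed at the end by
    monotonicity.\<close>
  interpret information_space ?M 2 by standard simp
  have sf: "simple_function ?M (\<lambda>x. x)"
    using A by (auto simp: simple_function_def sets_uniform_count_measure space_uniform_count_measure)
  note pos = avg_cond_size_pos[OF A(1) False]
  have "log 2 (card A) = entropy_rv 2 ?M (\<lambda>x. x)"
    using uniform_entropy_eq_log_card[OF A(1) False] by simp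
  also have "\<dots> \<le> (\<Sum>(S, k)\<in>occs \<S>. \<alpha> (S, k) *
      cond_entropy_rv 2 ?M (\<lambda>x. restrict x S) (\<lambda>x. restrict x (lower_star S)))"
    using A by (intro entropy_fractional_cover[OF sf _ cover sub])
      (auto simp: space_uniform_count_measure)
  also have "\<dots> \<le> (\<Sum>(S, k)\<in>occs \<S>. \<alpha> (S, k) * log 2 (avg_cond_size A S (lower_star S)))"
    using cover
    by (auto intro!: sum_mono mult_left_mono uniform_cond_entropy_le_log_avg_cond_size A False
        simp: fractional_cover_def)
  also have "\<dots> = log 2 ?P"
    unfolding log_def using pos
    by (subst ln_prod) (auto simp: sum_divide_distrib case_prod_beta' ln_powr finite_occs less_imp_neq[symmetric])
  finally have "log 2 (card A) \<le> log 2 ?P" .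
  moreover have "0 < ?P" using pos by (intro prod_pos) (auto simp: less_imp_neq[symmetric])
  moreover have "0 < card A" using A False by (simp add: card_gt_0_iff)
  ultimately show ?thesis by simp
qed

section \<open>The set and entropy inequalities together\<close>

theorem theorem3p2:
  fixes n :: nat and B :: "nat \<Rightarrow> 'b set"
    and \<S> :: "nat set multiset" and \<alpha> :: "nat set \<times> nat \<Rightarrow> real" and b :: real
  assumes "2 \<le> n"
    and "\<And>i. i \<in> {1..n} \<Longrightarrow> finite (B i)"
    and "\<And>S. S \<in># \<S> \<Longrightarrow> S \<subseteq> {1..n}"
    and "fractional_cover n \<S> \<alpha>"
    and "1 < b"
  shows "let \<X> = (\<Pi>\<^sub>E i\<in>{1..n}. B i);
             set_ineq = (\<forall>A. A \<subseteq> \<X> \<longrightarrow>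
               real (card A) \<le> (\<Prod>(S, k)\<in>occs \<S>. avg_cond_size A S (lower_star S) powr \<alpha> (S, k)));
             entropy_ineq = (\<forall>(M :: 'a measure) X. prob_space M \<and> X \<in> M \<rightarrow>\<^sub>M count_space \<X> \<longrightarrow>
               entropy_rv b M X \<le> (\<Sum>(S, k)\<in>occs \<S>. \<alpha> (S, k) *
                 cond_entropy_rv b M (\<lambda>\<omega>. restrict (X \<omega>) S) (\<lambda>\<omega>. restrict (X \<omega>) (lower_star S))))
         in set_ineq \<and> entropy_ineq \<and> (set_ineq \<longleftrightarrow> entropy_ineq)"
proof -
  let ?\<X> = "\<Pi>\<^sub>E i\<in>{1..n}. B i"
  have fin: "finite ?\<X>" using assms(2) by (intro finite_PiE) auto
  have ext: "?\<X> \<subseteq> extensional {1..n}" by (auto simp: PiE_def)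
  have sets: "real (card A) \<le> (\<Prod>(S, k)\<in>occs \<S>. avg_cond_size A S (lower_star S) powr \<alpha> (S, k))"
    if "A \<subseteq> ?\<X>" for A
    using that finite_subset[OF that fin] ext
    by (intro card_le_prod_avg_cond_size[OF _ _ assms(4,3)]) auto
  have entropies: "entropy_rv b M X \<le> (\<Sum>(S, k)\<in>occs \<S>. \<alpha> (S, k) *
      cond_entropy_rv b M (\<lambda>\<omega>. restrict (X \<omega>) S) (\<lambda>\<omega>. restrict (X \<omega>) (lower_star S)))"
    if "prob_space M" and X: "X \<in> M \<rightarrow>\<^sub>M count_space ?\<X>" for M :: "'a measure" and X
  proof -
    interpret information_space M b
      using that assms(5) by (simp add: information_space_def information_space_axioms_def)
    have range: "X ` space M \<subseteq> ?\<X>" using measurable_space[OF X] by auto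
    \<comment> \<open>Singletons are measurable in the counting space and the range is finite, so
      \<open>X\<close> is a simple function.\<close>
    have "X -` {x} \<inter> space M \<in> sets M" if "x \<in> X ` space M" for x
      using that range by (intro measurable_sets[OF X]) auto
    then have "simple_function M X"
      using finite_subset[OF range fin] by (simp add: simple_function_def)
    then show ?thesis
      using range ext by (intro entropy_fractional_cover[OF _ _ assms(4,3)]) auto
  qed
  \<comment> \<open>Both inequalities hold outright, so their equivalence is immediate.\<close>
  show ?thesis
    using sets entropies by (simp add: Let_def)
qed

end
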